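(* Let $\operatorname{Allow}:(\mathcal S\times\mathbb R^k)\times\mathcal A\to\{0,1\}$ be a gate that is sound for the budget $B_{d,\varepsilon}$, i.e. for all $z,a$: $\operatorname{Allow}(z,a)=1$ implies $\operatorname{Safe}(z',a)=1$ for all $z'\in B_{d,\varepsilon}(z)$. Then: 1. For all $z,a$: $\operatorname{Allow}(z,a)=1\Rightarrow m(z,a)\ge\varepsilon$; and the inequality is strict, $m(z,a)>\varepsilon$, when the unsafe set is closed. 2. Hence $\Pr[\operatorname{Allow}=1]\le\Pr[m\ge\varepsilon]$, with equality for the oracle robust gate up to the boundary event $\{m=\varepsilon\}$ (that is, the oracle robust gate is allowed with probability $\Pr[m\ge\varepsilon]-\Pr[m=\varepsilon]$). 3. Every joint-gap witness $(z,a)$, and every $(z,a)$ with $m(z,a)<\varepsilon$, is refused ($\operatorname{Allow}(z,a)=0$) by any sound gate.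
   Context: Returns are $z=(s,x)$ with $s\in\mathcal S$ (discrete part) and $x\in\mathbb R^k$ (continuous part); $\mathcal A$ is a set of actions; $\operatorname{Safe}(z,a)\in\{0,1\}$ is the safety predicate. $D_{\mathrm{disc}}$ is a distance on $\mathcal S$ counting discrete edits (nonnegative integer valued, $D_{\mathrm{disc}}(s,s)=0$); $d\ge0$ is an integer and $\varepsilon>0$. The discrete neighborhood $\mathcal N_d(s)=\{s'\in\mathcal S:D_{\mathrm{disc}}(s,s')\le d\}$ is assumed finite, and $$B_{d,\varepsilon}(s,x)=\{(s',x'):D_{\mathrm{disc}}(s,s')\le d,\ \|x'-x\|_2\le\varepsilon\}.$$ The worst-branch joint margin is $$m(z,a)=\min_{s'\in\mathcal N_d(s)}\inf\{\|x'-x\|_2:\ x'\in\mathbb R^k,\ \operatorname{Safe}((s',x'),a)=0\}$$ with $\inf\emptyset=+\infty$. "The unsafe set is closed" means that for every $s'\in\mathcal S$ and action $a$ the set $\{x'\in\mathbb R^k:\operatorname{Safe}((s',x'),a)=0\}$ is closed. The oracle robust gate allows exactly the robust-safe set $R=\{(z,a):m(z,a)>\varepsilon\}$. A joint-gap witness is a pair $(z,a)$, $z=(s,x)$, such that $\operatorname{Safe}((s,x'),a)=1$ for all $x'$ with $\|x'-x\|_2\le\varepsilon$, $\operatorname{Safe}((s',x),a)=1$ for all $s'\in\mathcal N_d(s)$, but $\operatorname{Safe}(z',a)=0$ for some $z'\in B_{d,\varepsilon}(z)$. Probabilities are with respect to an arbitrary distribution of the random pair $(z,a)$ for which the events involved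 are measurable. *)

theory Defs
  imports "HOL-Probability.Probability"
begin

text \<open>
  A return is a pair \<open>z = (s, x)\<close> with \<open>s :: 's\<close> the discrete part and \<open>x :: real ^ 'k\<close> the
  continuous part; \<open>norm\<close> on \<open>real ^ 'k\<close> is the Euclidean norm. Predicates with values in
  \<open>{0, 1}\<close> (safety, gates) are Boolean-valued functions of \<open>(z, a)\<close>.
\<close>

type_synonym ('s, 'k) ret = "'s \<times> (real ^ 'k)"

type_synonym ('s, 'k, 'a) verdict = "('s, 'k) ret \<times> 'a \<Rightarrow> bool"

definition disc_nbhd :: "('s \<Rightarrow> 's \<Rightarrow> nat) \<Rightarrow> nat \<Rightarrow> 's \<Rightarrow> 's set" where
  "disc_nbhd D d s = {s'. D s s' \<le> d}"

definition budget :: "('s \<Rightarrow> 's \<Rightarrow> nat) \<Rightarrow> nat \<Rightarrow> real \<Rightarrow> ('s, 'k::finite) ret \<Rightarrow> ('s, 'k::finite) ret set" where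
  "budget D d \<epsilon> z = {(s', x'). D (fst z) s' \<le> d \<and> norm (x' - snd z) \<le> \<epsilon>}"

text \<open>
  The infimum is taken in \<open>ereal\<close>, so it is \<open>\<infinity>\<close> over the empty set. The outer \<open>Min\<close> is
  meaningful because neighbourhoods are assumed finite and contain their centre.
\<close>

definition joint_margin ::
  "('s \<Rightarrow> 's \<Rightarrow> nat) \<Rightarrow> nat \<Rightarrow> ('s, 'k::finite, 'a) verdict \<Rightarrow> ('s, 'k::finite) ret \<times> 'a \<Rightarrow> ereal" where
  "joint_margin D d Safe = (\<lambda>((s, x), a).
     MIN s'\<in>disc_nbhd D d s. INF x'\<in>{x'. \<not> Safe ((s', x'), a)}. ereal (norm (x' - x)))"

definition sound_gate ::
  "('s \<Rightarrow> 's \<Rightarrow> nat) \<Rightarrow> nat \<Rightarrow> real \<Rightarrow> ('s, 'k::finite, 'a) verdict \<Rightarrow> ('s, 'k::finite, 'a) verdict \<Rightarrow> bool" where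
  "sound_gate D d \<epsilon> Safe Allow \<longleftrightarrow>
     (\<forall>z a. Allow (z, a) \<longrightarrow> (\<forall>z'\<in>budget D d \<epsilon> z. Safe (z', a)))"

definition unsafe_closed :: "('s, 'k::finite, 'a) verdict \<Rightarrow> bool" where
  "unsafe_closed Safe \<longleftrightarrow> (\<forall>s' a. closed {x'. \<not> Safe ((s', x'), a)})"

definition robust_safe_set ::
  "('s \<Rightarrow> 's \<Rightarrow> nat) \<Rightarrow> nat \<Rightarrow> real \<Rightarrow> ('s, 'k::finite, 'a) verdict \<Rightarrow> (('s, 'k::finite) ret \<times> 'a) set" where
  "robust_safe_set D d \<epsilon> Safe = {w. joint_margin D d Safe w > ereal \<epsilon>}"

definition oracle_gate ::
  "('s \<Rightarrow> 's \<Rightarrow> nat) \<Rightarrow> nat \<Rightarrow> real \<Rightarrow> ('s, 'k::finite, 'a) verdict \<Rightarrow> ('s, 'k::finite, 'a) verdict" where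
  "oracle_gate D d \<epsilon> Safe w \<longleftrightarrow> w \<in> robust_safe_set D d \<epsilon> Safe"

definition joint_gap_witness ::
  "('s \<Rightarrow> 's \<Rightarrow> nat) \<Rightarrow> nat \<Rightarrow> real \<Rightarrow> ('s, 'k::finite, 'a) verdict \<Rightarrow> ('s, 'k::finite) ret \<times> 'a \<Rightarrow> bool" where
  "joint_gap_witness D d \<epsilon> Safe = (\<lambda>((s, x), a).
     (\<forall>x'. norm (x' - x) \<le> \<epsilon> \<longrightarrow> Safe ((s, x'), a)) \<and>
     (\<forall>s'\<in>disc_nbhd D d s. Safe ((s', x), a)) \<and>
     (\<exists>z'\<in>budget D d \<epsilon> (s, x). \<not> Safe (z', a)))"

end

theory Submission
  imports Defs
begin

text \<open>Read soundness contrapositively: if the gate allows ((s, x), a), then an unsafe point x'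
  on a branch s' of the neighbourhood of s cannot lie in the budget, so its distance from x exceeds
  \<epsilon> (\<open>sound_gate_unsafe_far\<close>). Passing to the infimum on each branch can turn
  this strict bound into a weak one, and the minimum over branches keeps it, which gives margin at
  least \<epsilon>. If the unsafe slices are closed, the infimum over a nonempty slice is attained
  in the Euclidean space (\<open>less_INF_dist_closed\<close>), so strictness survives on every
  branch, and then in the minimum of finitely many branches.

  The probability bound is monotonicity of measure under the resulting inclusion of events, and the
  oracle identity splits the boundary event off the event that the margin is at least \<epsilon>.
  Refusal below \<epsilon> is the contrapositive of the margin bound; a joint-gap witness exhibits
  an unsafe point of the budget, which soundness forbids for an allowed pair.\<close>

lemma self_in_disc_nbhd:
  assumes "D s s = 0"
  shows "s \<in> disc_nbhd D d s"
  using assms by (simp add: disc_nbhd_def)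

text \<open>A weak lower bound passes through both \<open>Min\<close> and \<open>INF\<close>, so the
  condition becomes pointwise. The centre s belongs to its own neighbourhood, so \<open>Min\<close>
  ranges over a nonempty finite set.\<close>

lemma joint_margin_ge_iff:
  assumes "finite (disc_nbhd D d s)" and "D s s = 0"
  shows "ereal \<epsilon> \<le> joint_margin D d Safe ((s, x), a) \<longleftrightarrow>
    (\<forall>s'\<in>disc_nbhd D d s. \<forall>x'. \<not> Safe ((s', x'), a) \<longrightarrow> \<epsilon> \<le> norm (x' - x))"
  unfolding joint_margin_def prod.case using assms self_in_disc_nbhd[of D s d]
  by (subst Min_ge_iff) (auto simp: le_INF_iff)

text \<open>A strict bound passes through a finite \<open>Min\<close> but in general not through
  \<open>INF\<close>, so the reduction stops at the infimum of each branch.\<close>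

lemma joint_margin_gt_iff:
  assumes "finite (disc_nbhd D d s)" and "D s s = 0"
  shows "ereal \<epsilon> < joint_margin D d Safe ((s, x), a) \<longleftrightarrow>
    (\<forall>s'\<in>disc_nbhd D d s.
      ereal \<epsilon> < (INF x'\<in>{x'. \<not> Safe ((s', x'), a)}. ereal (norm (x' - x))))"
  unfolding joint_margin_def prod.case using assms self_in_disc_nbhd[of D s d]
  by (subst Min_gr_iff) auto

text \<open>In a Heine-Borel space a nonempty closed set has a point nearest to x, so the infimum is
  one of the distances already known to exceed r.\<close>

lemma less_INF_dist_closed:
  fixes U :: "'b::heine_borel set" and x :: 'b
  assumes "closed U" and "\<And>y. y \<in> U \<Longrightarrow> r < dist x y"
  shows "ereal r < (INF y\<in>U. ereal (dist x y))"
proof (cases "U = {}")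
  \<comment> \<open>The infimum over the empty set is \<infinity>, which exceeds every real.\<close>
  case True
  then show ?thesis by (simp add: top_ereal_def)
next
  case False
  then obtain y where y: "y \<in> U" "\<And>z. z \<in> U \<Longrightarrow> dist x y \<le> dist x z"
    using distance_attains_inf[OF assms(1) False, of x] by metis
  have "ereal r < ereal (dist x y)" using assms(2) y(1) by simp
  also have "\<dots> \<le> (INF y\<in>U. ereal (dist x y))" using y(2) by (simp add: le_INF_iff)
  finally show ?thesis .
qed

lemma sound_gate_unsafe_far:
  assumes "sound_gate D d \<epsilon> Safe Allow" and "Allow ((s, x), a)"
    and "s' \<in> disc_nbhd D d s" and "\<not> Safe ((s', x'), a)"
  shows "\<epsilon> < norm (x' - x)"
  using assms unfolding sound_gate_def budget_def disc_nbhd_def by force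

lemma sound_gate_joint_margin_ge:
  assumes "sound_gate D d \<epsilon> Safe Allow" and "Allow ((s, x), a)"
    and "finite (disc_nbhd D d s)" and "D s s = 0"
  shows "ereal \<epsilon> \<le> joint_margin D d Safe ((s, x), a)"
  unfolding joint_margin_ge_iff[where D=D and s=s and d=d, OF assms(3,4)]
  using sound_gate_unsafe_far[where Allow=Allow and s=s and x=x and a=a, OF assms(1,2)] by (blast intro: less_imp_le)

lemma sound_gate_joint_margin_gt:
  assumes "sound_gate D d \<epsilon> Safe Allow" and "Allow ((s, x), a)"
    and "finite (disc_nbhd D d s)" and "D s s = 0" and "unsafe_closed Safe"
  shows "ereal \<epsilon> < joint_margin D d Safe ((s, x), a)"
proof -
  \<comment> \<open>On each branch the closed set is the unsafe slice over s', and soundness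
    supplies the pointwise strict bound.\<close>
  have "ereal \<epsilon> < (INF x'\<in>{x'. \<not> Safe ((s', x'), a)}. ereal (norm (x' - x)))"
    if s': "s' \<in> disc_nbhd D d s" for s'
    using less_INF_dist_closed[of "{x'. \<not> Safe ((s', x'), a)}" \<epsilon> x] assms(5)
      sound_gate_unsafe_far[where Allow=Allow and s=s and x=x and a=a, OF assms(1,2) s']
    by (simp add: unsafe_closed_def dist_norm norm_minus_commute)
  then show ?thesis
    unfolding joint_margin_gt_iff[where D=D and s=s and d=d, OF assms(3,4)] ..
qed

lemma sound_gate_refuses_joint_gap:
  assumes "sound_gate D d \<epsilon> Safe Allow" and "joint_gap_witness D d \<epsilon> Safe (z, a)"
  shows "\<not> Allow (z, a)"
  using assms by (cases z) (auto simp: sound_gate_def joint_gap_witness_def)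

lemma measure_oracle_gate:
  assumes "prob_space P"
    and "{w \<in> space P. joint_margin D d Safe w \<ge> ereal \<epsilon>} \<in> sets P"
    and "{w \<in> space P. joint_margin D d Safe w = ereal \<epsilon>} \<in> sets P"
  shows "measure P {w \<in> space P. oracle_gate D d \<epsilon> Safe w} =
    measure P {w \<in> space P. joint_margin D d Safe w \<ge> ereal \<epsilon>} -
    measure P {w \<in> space P. joint_margin D d Safe w = ereal \<epsilon>}"
proof -
  interpret prob_space P by fact
  have "{w \<in> space P. oracle_gate D d \<epsilon> Safe w} =
      {w \<in> space P. joint_margin D d Safe w \<ge> ereal \<epsilon>} -
      {w \<in> space P. joint_margin D d Safe w = ereal \<epsilon>}"
    by (auto simp: oracle_gate_def robust_safe_set_def)
  moreover have "{w \<in> space P. joint_margin D d Safe w = ereal \<epsilon>} \<subseteq>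
      {w \<in> space P. joint_margin D d Safe w \<ge> ereal \<epsilon>}"
    by auto
  ultimately show ?thesis using finite_measure_Diff[OF assms(2,3)] by simp
qed

theorem proposition3:
  fixes D :: "'s \<Rightarrow> 's \<Rightarrow> nat"
    and d :: nat
    and \<epsilon> :: real
    and Safe :: "('s \<times> (real ^ 'k)) \<times> 'a \<Rightarrow> bool"
    and Allow :: "('s \<times> (real ^ 'k)) \<times> 'a \<Rightarrow> bool"
  assumes D_refl: "\<And>s. D s s = 0"
    and eps_pos: "\<epsilon> > 0"
    and nbhd_finite: "\<And>s. finite (disc_nbhd D d s)"
    and sound: "sound_gate D d \<epsilon> Safe Allow"
  shows
    "(\<forall>z a. Allow (z, a) \<longrightarrow> joint_margin D d Safe (z, a) \<ge> ereal \<epsilon>) \<and>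
     (unsafe_closed Safe \<longrightarrow>
        (\<forall>z a. Allow (z, a) \<longrightarrow> joint_margin D d Safe (z, a) > ereal \<epsilon>)) \<and>
     (\<forall>P :: (('s \<times> (real ^ 'k)) \<times> 'a) measure.
        prob_space P \<and>
        {w \<in> space P. Allow w} \<in> sets P \<and>
        {w \<in> space P. joint_margin D d Safe w \<ge> ereal \<epsilon>} \<in> sets P \<longrightarrow>
        measure P {w \<in> space P. Allow w} \<le>
        measure P {w \<in> space P. joint_margin D d Safe w \<ge> ereal \<epsilon>}) \<and>
     (\<forall>P :: (('s \<times> (real ^ 'k)) \<times> 'a) measure.
        prob_space P \<and>
        {w \<in> space P. joint_margin D d Safe w \<ge> ereal \<epsilon>} \<in> sets P \<and>
        {w \<in> space P. joint_margin D d Safe w = ereal \<epsilon>} \<in> sets P \<longrightarrow>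
        measure P {w \<in> space P. oracle_gate D d \<epsilon> Safe w} =
        measure P {w \<in> space P. joint_margin D d Safe w \<ge> ereal \<epsilon>} -
        measure P {w \<in> space P. joint_margin D d Safe w = ereal \<epsilon>}) \<and>
     (\<forall>z a. joint_gap_witness D d \<epsilon> Safe (z, a) \<longrightarrow> \<not> Allow (z, a)) \<and>
     (\<forall>z a. joint_margin D d Safe (z, a) < ereal \<epsilon> \<longrightarrow> \<not> Allow (z, a))"
proof (intro conjI allI impI)
  \<comment> \<open>This bound serves three claims: the margin bound itself, refusal below
    \<epsilon> by contraposition, and the inclusion of events behind the probability
    inequality.\<close>
  have ge: "ereal \<epsilon> \<le> joint_margin D d Safe w" if "Allow w" for w
    using sound_gate_joint_margin_ge[OF sound _ nbhd_finite D_refl] that by (cases w; cases "fst w") auto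
  show "ereal \<epsilon> \<le> joint_margin D d Safe (z, a)" if "Allow (z, a)" for z a
    using ge that .
  show "ereal \<epsilon> < joint_margin D d Safe (z, a)" if "unsafe_closed Safe" "Allow (z, a)" for z a
    using sound_gate_joint_margin_gt[OF sound _ nbhd_finite D_refl] that by (cases z) blast
  show "\<not> Allow (z, a)" if "joint_margin D d Safe (z, a) < ereal \<epsilon>" for z a
    using ge[of "(z, a)"] that by auto
  show "\<not> Allow (z, a)" if "joint_gap_witness D d \<epsilon> Safe (z, a)" for z a
    using sound_gate_refuses_joint_gap[OF sound that] .
  fix P :: "(('s \<times> (real ^ 'k)) \<times> 'a) measure"
  assume P: "prob_space P \<and> {w \<in> space P. Allow w} \<in> sets P \<and>
    {w \<in> space P. joint_margin D d Safe w \<ge> ereal \<epsilon>} \<in> sets P"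
  then interpret prob_space P by blast
  have "{w \<in> space P. Allow w} \<subseteq> {w \<in> space P. joint_margin D d Safe w \<ge> ereal \<epsilon>}"
    using ge by blast
  then show "measure P {w \<in> space P. Allow w} \<le>
      measure P {w \<in> space P. joint_margin D d Safe w \<ge> ereal \<epsilon>}"
    using P by (intro finite_measure_mono) auto
next
  fix P :: "(('s \<times> (real ^ 'k)) \<times> 'a) measure"
  assume "prob_space P \<and>
    {w \<in> space P. joint_margin D d Safe w \<ge> ereal \<epsilon>} \<in> sets P \<and>
    {w \<in> space P. joint_margin D d Safe w = ereal \<epsilon>} \<in> sets P"
  then show "measure P {w \<in> space P. oracle_gate D d \<epsilon> Safe w} =
      measure P {w \<in> space P. joint_margin D d Safe w \<ge> ereal \<epsilon>} -
      measure P {w \<in> space P. joint_margin D d Safe w = ereal \<epsilon>}"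
    using measure_oracle_gate[where P=P and D=D and d=d and Safe=Safe and \<epsilon>=\<epsilon>] by blast
qed

end
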